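(* Let $q$ be a prime power and let $\mathbb{F}_q[t,t^{-1}]$ be the ring of Laurent polynomials over the finite field $\mathbb{F}_q$, regarded as an abelian group under addition. For any field $F$ and any linear algebraic group $\mathbf{G}$ over $F$, there is no embedding (injective group homomorphism) $\operatorname{Comm}(\mathbb{F}_q[t,t^{-1}])\to\mathbf{G}(F)$.
   Context: A partial automorphism of a group $\Gamma$ is an isomorphism between two finite-index subgroups of $\Gamma$; two are equivalent if they agree on some finite-index subgroup. The abstract commensurator $\operatorname{Comm}(\Gamma)$ is the group of equivalence classes of partial automorphisms under composition. In the paper, $\mathbb{F}_q[t,t^{-1}]$ arises as the ring $K(S)$ of $S$-integral elements of the global field $K=\mathbb{F}_q(t)$ for $S=\{v_t,v_\infty\}$, and its additive group is the $S$-arithmetic group $\mathbf{G}_a(K(S))$, where $\mathbf{G}_a$ is the one-dimensional additive group. As an abstract group it is isomorphic to $\bigoplus_{k=-\infty}^{\infty}\mathbb{F}_q$. *)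

theory Defs
  imports
    "HOL-Library.Poly_Mapping"
    "HOL-Algebra.Coset"
    "HOL-Algebra.Algebraic_Closure_Type"
    "Jordan_Normal_Form.Matrix"
begin

section \<open>The abstract commensurator\<close>

definition finite_index_subgroup :: "'a set \<Rightarrow> ('a, 'b) monoid_scheme \<Rightarrow> bool" where
  "finite_index_subgroup H G \<longleftrightarrow> subgroup H G \<and> finite (rcosets\<^bsub>G\<^esub> H)"

text \<open>
  A partial automorphism is stored as its domain together with the map; the codomain is the image.
  The map is required to be \<^const>\<open>extensional\<close>, so that the pair is determined by the values of
  the map on the domain.
\<close>

definition partial_automorphisms :: "('a, 'b) monoid_scheme \<Rightarrow> ('a set \<times> ('a \<Rightarrow> 'a)) set" where
  "partial_automorphisms G =
    {(H, \<phi>). finite_index_subgroup H G \<and> finite_index_subgroup (\<phi> ` H) G \<and>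
      \<phi> \<in> extensional H \<and> \<phi> \<in> iso (G\<lparr>carrier := H\<rparr>) (G\<lparr>carrier := \<phi> ` H\<rparr>)}"

definition partial_automorphism_rel ::
    "('a, 'b) monoid_scheme \<Rightarrow> (('a set \<times> ('a \<Rightarrow> 'a)) \<times> ('a set \<times> ('a \<Rightarrow> 'a))) set" where
  "partial_automorphism_rel G =
    {((H, \<phi>), (K, \<psi>)). (H, \<phi>) \<in> partial_automorphisms G \<and> (K, \<psi>) \<in> partial_automorphisms G \<and>
      (\<exists>L. finite_index_subgroup L G \<and> L \<subseteq> H \<inter> K \<and> (\<forall>x\<in>L. \<phi> x = \<psi> x))}"

text \<open>First apply the second argument, on the largest domain on which the composite is defined.\<close>

fun partial_automorphism_comp ::
    "'a set \<times> ('a \<Rightarrow> 'a) \<Rightarrow> 'a set \<times> ('a \<Rightarrow> 'a) \<Rightarrow> 'a set \<times> ('a \<Rightarrow> 'a)" where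
  "partial_automorphism_comp (H, \<phi>) (K, \<psi>) =
    (let D = {x \<in> K. \<psi> x \<in> H} in (D, restrict (\<phi> \<circ> \<psi>) D))"

text \<open>
  The product of two classes is the union of the classes of all composites of representatives;
  these composites are pairwise equivalent.
\<close>

definition commensurator :: "('a, 'b) monoid_scheme \<Rightarrow> ('a set \<times> ('a \<Rightarrow> 'a)) set monoid" where
  "commensurator G =
    \<lparr>carrier = partial_automorphisms G // partial_automorphism_rel G,
     monoid.mult = (\<lambda>A B. \<Union>p\<in>A. \<Union>r\<in>B. partial_automorphism_rel G `` {partial_automorphism_comp p r}),
     one = partial_automorphism_rel G `` {(carrier G, restrict id (carrier G))}\<rparr>"


section \<open>Laurent polynomials\<close>

text \<open>
  Finitely supported functions from the integers (exponents of \<open>t\<close>) to the coefficients;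
  the multiplication of \<^theory>\<open>HOL-Library.Poly_Mapping\<close> is convolution, so this is
  the ring \<open>R[t, t\<^sup>-\<^sup>1]\<close>.
\<close>

type_synonym 'r laurent_poly = "int \<Rightarrow>\<^sub>0 'r"

definition additive_group :: "'a::ab_group_add monoid" where
  "additive_group = \<lparr>carrier = UNIV, monoid.mult = (+), one = 0\<rparr>"


section \<open>Linear algebraic groups\<close>

definition GL :: "nat \<Rightarrow> 'a::field mat monoid" where
  "GL n = units_of (ring_mat TYPE('a) n ())"

text \<open>Polynomials in the matrix entries: the variable \<open>(i, j)\<close> stands for the entry at \<open>(i, j)\<close>.\<close>

type_synonym 'f entry_poly = "((nat \<times> nat) \<Rightarrow>\<^sub>0 nat) \<Rightarrow>\<^sub>0 'f"

definition entry_polys :: "nat \<Rightarrow> 'f::zero entry_poly set" where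
  "entry_polys n = {p. \<forall>m \<in> Poly_Mapping.keys p. Poly_Mapping.keys m \<subseteq> {..<n} \<times> {..<n}}"

definition eval_entry_poly :: "'f::field entry_poly \<Rightarrow> 'f alg_closure mat \<Rightarrow> 'f alg_closure" where
  "eval_entry_poly p A =
    (\<Sum>m \<in> Poly_Mapping.keys p. to_ac (Poly_Mapping.lookup p m) *
      (\<Prod>v \<in> Poly_Mapping.keys m. (A $$ v) ^ Poly_Mapping.lookup m v))"

text \<open>
  A linear algebraic group over \<open>F\<close> is given by its points over the algebraic closure of \<open>F\<close>:
  a subgroup of \<open>GL n\<close> that is the zero set of polynomials with coefficients in \<open>F\<close>. Polynomials
  in the entries and the inverse of the determinant cut out the same subsets of \<open>GL n\<close>.
  The vanishing ideal over the algebraic closure is not required to be generated by polynomials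
  over \<open>F\<close>. For imperfect \<open>F\<close> this admits, besides the groups defined over \<open>F\<close> in the strict sense,
  the point sets of non-reduced closed subgroup schemes of \<open>GL n\<close>.
\<close>

definition linear_algebraic_group :: "nat \<Rightarrow> 'f::field alg_closure mat set \<Rightarrow> bool" where
  "linear_algebraic_group n G \<longleftrightarrow>
    subgroup G (GL n) \<and>
    (\<exists>P \<subseteq> entry_polys n. G = {A \<in> carrier (GL n). \<forall>p\<in>P. eval_entry_poly p A = 0})"

definition rational_points :: "nat \<Rightarrow> 'f::field alg_closure mat set \<Rightarrow> 'f mat monoid" where
  "rational_points n G = (GL n)\<lparr>carrier := {A \<in> carrier (GL n). map_mat to_ac A \<in> G}\<rparr>"

end

theory Submission
  imports Defs "HOL-Library.Nat_Bijection" "Jordan_Normal_Form.Determinant"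
begin

text \<open>
  \<open>Comm(V)\<close> for \<open>V = \<Oplus>\<^sub>\<int> F\<^sub>q\<close> contains elements \<open>a\<^sub>0, a\<^sub>1, \<dots>\<close> and \<open>b\<^sub>0, b\<^sub>1, \<dots>\<close> such that \<open>a\<^sub>i\<close> and
  \<open>b\<^sub>j\<close> commute iff \<open>i \<noteq> j\<close>: identify \<open>\<int>\<close> with \<open>\<nat> \<times> \<int>\<close> and let \<open>a\<^sub>i\<close>, \<open>b\<^sub>i\<close> permute the coordinates in
  row \<open>i\<close> by \<open>x \<mapsto> -x\<close> and \<open>x \<mapsto> 1 - x\<close>. In \<open>n \<times> n\<close> matrices over a field this is impossible: a linear
  relation \<open>\<Sum> c\<^sub>i b\<^sub>i = 0\<close> yields \<open>c\<^sub>j [a\<^sub>j, b\<^sub>j] = 0\<close> after taking the commutator with \<open>a\<^sub>j\<close>, so the \<open>b\<^sub>i\<close>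
  would be linearly independent.
\<close>

section \<open>Commutation patterns of matrices\<close>

text \<open>The \<open>m * n\<close> entries give as many homogeneous equations in
  \<open>m * n + 1\<close> unknowns. A zero row makes the system square, so that its determinant can
  be used.\<close>

lemma mat_family_linearly_dependent:
  fixes Y :: "nat \<Rightarrow> 'f::field mat"
  obtains c k where "k \<le> m * n" "c k \<noteq> 0"
    "\<And>r s. r < m \<Longrightarrow> s < n \<Longrightarrow> (\<Sum>k\<le>m * n. c k * Y k $$ (r, s)) = 0"
proof -
  define N where "N = Suc (m * n)"
  \<comment> \<open>Row \<open>r * n + s\<close> lists the entry \<open>(r, s)\<close> of every
    \<open>Y k\<close>; the last row, of index \<open>m * n\<close>, is the padding.\<close>
  define M where "M = mat N N (\<lambda>(i, k). if i < m * n then Y k $$ (i div n, i mod n) else 0)"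
  have M: "M \<in> carrier_mat N N"
    by (simp add: M_def)
  have "det M = (\<Sum>j<N. M $$ (m * n, j) * cofactor M (m * n) j)"
    by (rule laplace_expansion_row[OF M]) (simp add: N_def)
  also have "\<dots> = 0"
    by (rule sum.neutral) (auto simp: M_def N_def)
  finally obtain v where v: "v \<in> carrier_vec N" "v \<noteq> 0\<^sub>v N" "M *\<^sub>v v = 0\<^sub>v N"
    using det_0_iff_vec_prod_zero_field[OF M] by blast
  obtain k where k: "k < N" "v $ k \<noteq> 0"
    using v(1,2) by (metis carrier_vecD eq_vecI index_zero_vec(1) index_zero_vec(2))
  show thesis
  proof (rule that[of k "\<lambda>k. v $ k"])
    fix r s
    assume r: "r < m" and s: "s < n"
    have "r * n + s < r * n + n"
      using s by simp
    also have "\<dots> \<le> m * n"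
      using r by (metis Suc_leI add.commute mult_Suc mult_le_mono1)
    finally have lt: "r * n + s < m * n" .
    have "0 = (M *\<^sub>v v) $ (r * n + s)"
      using lt v(3) by (simp add: N_def)
    also have "\<dots> = (\<Sum>k<N. M $$ (r * n + s, k) * v $ k)"
      using lt v(1) M by (simp add: N_def scalar_prod_def lessThan_atLeast0)
    also have "\<dots> = (\<Sum>k\<le>m * n. v $ k * Y k $$ (r, s))"
      using lt s by (auto simp: M_def N_def lessThan_Suc_atMost mult.commute intro!: sum.cong)
    finally show "(\<Sum>k\<le>m * n. v $ k * Y k $$ (r, s)) = 0"
      by simp
  qed (use k in \<open>auto simp: N_def\<close>)
qed

lemma mat_commutation_pattern:
  fixes A B :: "nat \<Rightarrow> 'f::field mat"
  assumes A: "\<And>i. A i \<in> carrier_mat n n" and B: "\<And>i. B i \<in> carrier_mat n n"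
    and comm: "\<And>i j. i \<noteq> j \<Longrightarrow> A i * B j = B j * A i"
  obtains i where "A i * B i = B i * A i"
proof -
  obtain c j where j: "j \<le> n * n" "c j \<noteq> 0"
    and rel: "\<And>r s. r < n \<Longrightarrow> s < n \<Longrightarrow> (\<Sum>k\<le>n * n. c k * B k $$ (r, s)) = 0"
    using mat_family_linearly_dependent[of n n B] by metis
  have AB: "(A j * B k) $$ (r, s) = (\<Sum>l<n. A j $$ (r, l) * B k $$ (l, s))"
    and BA: "(B k * A j) $$ (r, s) = (\<Sum>l<n. B k $$ (r, l) * A j $$ (l, s))"
    if "r < n" "s < n" for k r s
    using that A[of j] B[of k] by (auto simp: scalar_prod_def lessThan_atLeast0)
  have "A j * B j = B j * A j"
  proof (rule eq_matI)
    fix r s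
    assume "r < dim_row (B j * A j)" "s < dim_col (B j * A j)"
    then have rs: "r < n" "s < n"
      using A[of j] B[of j] by auto
    \<comment> \<open>Entry of \<open>A j\<close> times the linear combination of the
      \<open>B k\<close>, which is the zero matrix; likewise below with \<open>A j\<close> on the
      right.\<close>
    have "(\<Sum>k\<le>n * n. c k * (A j * B k) $$ (r, s)) =
        (\<Sum>l<n. A j $$ (r, l) * (\<Sum>k\<le>n * n. c k * B k $$ (l, s)))"
      unfolding AB[OF rs] sum_distrib_left by (subst sum.swap) (simp add: ac_simps)
    also have "\<dots> = 0"
      using rel rs by simp
    finally have 1: "(\<Sum>k\<le>n * n. c k * (A j * B k) $$ (r, s)) = 0" .
    have "(\<Sum>k\<le>n * n. c k * (B k * A j) $$ (r, s)) =
        (\<Sum>l<n. A j $$ (l, s) * (\<Sum>k\<le>n * n. c k * B k $$ (r, l)))"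
      unfolding BA[OF rs] sum_distrib_left by (subst sum.swap) (simp add: ac_simps)
    also have "\<dots> = 0"
      using rel rs by simp
    finally have 2: "(\<Sum>k\<le>n * n. c k * (B k * A j) $$ (r, s)) = 0" .
    have "0 = (\<Sum>k\<le>n * n. c k * ((A j * B k) $$ (r, s) - (B k * A j) $$ (r, s)))"
      using 1 2 by (simp add: right_diff_distrib sum_subtractf)
    \<comment> \<open>For \<open>k\<close> other than \<open>j\<close> the commutator of
      \<open>A j\<close> and \<open>B k\<close> vanishes.\<close>
    also have "\<dots> = (\<Sum>k\<in>{j}. c k * ((A j * B k) $$ (r, s) - (B k * A j) $$ (r, s)))"
      using j comm by (intro sum.mono_neutral_right) auto
    finally show "(A j * B j) $$ (r, s) = (B j * A j) $$ (r, s)"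
      using j by simp
  qed (use A[of j] B[of j] in auto)
  then show thesis
    by (rule that)
qed


section \<open>Automorphisms in the abstract commensurator\<close>

context group
begin

text \<open>Each fibre of \<open>f\<close> lies in a single right coset of \<open>H\<close>, so
  there are at most as many cosets as values of \<open>f\<close>. Leaving the type of the values
  free lets cosets of other subgroups, or pairs of them, serve as invariants.\<close>

lemma finite_index_subgroupI:
  assumes H: "subgroup H G" and fin: "finite (f ` carrier G)"
    and sep: "\<And>x y. x \<in> carrier G \<Longrightarrow> y \<in> carrier G \<Longrightarrow> f x = f y \<Longrightarrow> x \<otimes> inv y \<in> H"
  shows "finite_index_subgroup H G"
proof -
  define g where "g c = H #> (SOME x. x \<in> carrier G \<and> f x = c)" for c
  have "rcosets H \<subseteq> g ` f ` carrier G"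
  proof
    fix C
    assume "C \<in> rcosets H"
    then obtain x where x: "x \<in> carrier G" "C = H #> x"
      unfolding RCOSETS_def by auto
    define y where "y = (SOME y. y \<in> carrier G \<and> f y = f x)"
    have y: "y \<in> carrier G" "f y = f x"
      using someI[of "\<lambda>y. y \<in> carrier G \<and> f y = f x", OF conjI[OF x(1) refl]]
      by (auto simp: y_def)
    have "y \<in> H #> x"
      using subgroup.rcos_module_rev[OF H is_group x(1) y(1)] sep[OF y(1) x(1) y(2)] by blast
    then have "C = g (f x)"
      using repr_independence[OF _ x(1) H] x(2) by (simp add: g_def y_def)
    then show "C \<in> g ` f ` carrier G"
      using x(1) by blast
  qed
  then show ?thesis
    using H fin by (auto simp: finite_index_subgroup_def intro: finite_subset)
qed

lemma finite_index_subgroupD: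
  assumes "finite_index_subgroup H G"
  shows "subgroup H G" "finite ((\<lambda>x. H #> x) ` carrier G)"
    "\<And>x y. x \<in> carrier G \<Longrightarrow> y \<in> carrier G \<Longrightarrow> H #> x = H #> y \<Longrightarrow> x \<otimes> inv y \<in> H"
proof -
  show H: "subgroup H G"
    using assms by (simp add: finite_index_subgroup_def)
  have "rcosets H = (\<lambda>x. H #> x) ` carrier G"
    unfolding RCOSETS_def by auto
  then show "finite ((\<lambda>x. H #> x) ` carrier G)"
    using assms by (simp add: finite_index_subgroup_def)
  show "x \<otimes> inv y \<in> H" if "x \<in> carrier G" "y \<in> carrier G" "H #> x = H #> y" for x y
    using that H by (metis is_group rcos_self subgroup.rcos_module_imp)
qed

lemma finite_index_subgroup_carrier: "finite_index_subgroup (carrier G) G"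
  by (rule finite_index_subgroupI[of _ "\<lambda>_. ()"]) (auto intro: subgroup_self)

text \<open>The pair of cosets is a finite invariant that separates the cosets of the
  intersection.\<close>

lemma finite_index_subgroup_Int:
  assumes "finite_index_subgroup H G" "finite_index_subgroup K G"
  shows "finite_index_subgroup (H \<inter> K) G"
proof (rule finite_index_subgroupI)
  note H = finite_index_subgroupD[OF assms(1)] and K = finite_index_subgroupD[OF assms(2)]
  show "subgroup (H \<inter> K) G"
    by (rule subgroups_Inter_pair[OF H(1) K(1)])
  show "finite ((\<lambda>x. (H #> x, K #> x)) ` carrier G)"
    by (rule finite_subset[OF _ finite_cartesian_product[OF H(2) K(2)]]) auto
  show "x \<otimes> inv y \<in> H \<inter> K"
    if "x \<in> carrier G" "y \<in> carrier G" "(H #> x, K #> x) = (H #> y, K #> y)" for x y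
    using that H(3) K(3) by auto
qed

text \<open>The invariant of \<open>x\<close> is the coset of its image, one of the finitely many
  cosets of \<open>H\<close>.\<close>

lemma finite_index_subgroup_vimage:
  assumes "finite_index_subgroup H G" and "\<phi> \<in> hom G G"
  shows "finite_index_subgroup {x \<in> carrier G. \<phi> x \<in> H} G"
proof -
  interpret \<phi>: group_hom G G \<phi>
    by unfold_locales (rule assms(2))
  note H = finite_index_subgroupD[OF assms(1)]
  show ?thesis
  proof (rule finite_index_subgroupI)
    have "\<one> \<in> {x \<in> carrier G. \<phi> x \<in> H}"
      using subgroup.one_closed[OF H(1)] by simp
    then show "subgroup {x \<in> carrier G. \<phi> x \<in> H} G"
      by (intro subgroupI)
        (auto intro: subgroup.m_closed[OF H(1)] subgroup.m_inv_closed[OF H(1)])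
    show "finite ((\<lambda>x. H #> \<phi> x) ` carrier G)"
      by (rule finite_subset[OF _ H(2)]) auto
    show "x \<otimes> inv y \<in> {x \<in> carrier G. \<phi> x \<in> H}"
      if "x \<in> carrier G" "y \<in> carrier G" "H #> \<phi> x = H #> \<phi> y" for x y
      using that H(3)[of "\<phi> x" "\<phi> y"] by simp
  qed
qed

end

text \<open>Meant for automorphisms of the whole group. The restriction makes the representative
  extensional, as partial automorphisms have to be.\<close>

definition commensurator_class :: "('a, 'b) monoid_scheme \<Rightarrow> ('a \<Rightarrow> 'a) \<Rightarrow> ('a set \<times> ('a \<Rightarrow> 'a)) set" where
  "commensurator_class G \<phi> =
    partial_automorphism_rel G `` {(carrier G, restrict \<phi> (carrier G))}"

context group
begin

lemma automorphism_partial_automorphism: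
  assumes "\<phi> \<in> iso G G"
  shows "(carrier G, restrict \<phi> (carrier G)) \<in> partial_automorphisms G"
  using assms finite_index_subgroup_carrier
  by (auto simp: partial_automorphisms_def iso_def hom_def bij_betw_def inj_on_def)

lemma partial_automorphism_rel_refl:
  assumes "p \<in> partial_automorphisms G"
  shows "(p, p) \<in> partial_automorphism_rel G"
  using assms by (cases p) (auto simp: partial_automorphism_rel_def partial_automorphisms_def)

lemma commensurator_class_closed:
  assumes "\<phi> \<in> iso G G"
  shows "commensurator_class G \<phi> \<in> carrier (commensurator G)"
  using automorphism_partial_automorphism[OF assms]
  by (auto simp: commensurator_def commensurator_class_def quotient_def)

text \<open>The standard representative is defined on all of \<open>G\<close>, so the common domain
  \<open>L\<close> is constrained only by \<open>K\<close>, and on \<open>L\<close> the restriction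
  of \<phi> disappears.\<close>

lemma mem_commensurator_class_iff:
  assumes "\<phi> \<in> iso G G"
  shows "(K, \<psi>) \<in> commensurator_class G \<phi> \<longleftrightarrow> (K, \<psi>) \<in> partial_automorphisms G \<and>
    (\<exists>L. finite_index_subgroup L G \<and> L \<subseteq> K \<and> (\<forall>x\<in>L. \<psi> x = \<phi> x))"
  using automorphism_partial_automorphism[OF assms]
  by (fastforce simp: commensurator_class_def partial_automorphism_rel_def finite_index_subgroup_def
      dest: subgroup.mem_carrier)

lemma commensurator_class_eqD:
  assumes "\<phi> \<in> iso G G" "\<psi> \<in> iso G G" "commensurator_class G \<phi> = commensurator_class G \<psi>"
  obtains L where "finite_index_subgroup L G" "\<And>x. x \<in> L \<Longrightarrow> \<phi> x = \<psi> x"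
proof -
  have "(carrier G, restrict \<phi> (carrier G)) \<in> commensurator_class G \<psi>"
    using partial_automorphism_rel_refl[OF automorphism_partial_automorphism[OF assms(1)]] assms(3)
    by (auto simp: commensurator_class_def)
  then show thesis
    using that by (auto simp: mem_commensurator_class_iff[OF assms(2)] subset_iff)
qed

text \<open>
  The product is a union over all pairs of representatives. Those whose composite is not a partial
  automorphism would contribute the empty set, so closure under composition plays no role.
\<close>

lemma commensurator_class_mult:
  assumes \<phi>: "\<phi> \<in> iso G G" and \<psi>: "\<psi> \<in> iso G G"
  shows "commensurator_class G \<phi> \<otimes>\<^bsub>commensurator G\<^esub> commensurator_class G \<psi> =
    commensurator_class G (\<phi> \<circ> \<psi>)"
proof -
  have \<phi>\<psi>: "\<phi> \<circ> \<psi> \<in> iso G G"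
    using iso_set_trans[OF \<psi> \<phi>] by (simp add: comp_def compose_def)
  have closed: "\<psi> x \<in> carrier G" if "x \<in> carrier G" for x
    using \<psi> that by (auto simp: iso_def hom_def)
  have sub: "partial_automorphism_rel G `` {partial_automorphism_comp p r} \<subseteq> commensurator_class G (\<phi> \<circ> \<psi>)"
    if p: "p \<in> commensurator_class G \<phi>" and r: "r \<in> commensurator_class G \<psi>" for p r
  \<comment> \<open>A class is a set of pairs (domain, map), so its inclusion can be proved as that
    of a relation.\<close>
  proof (rule subrelI)
    fix K' \<kappa>
    assume "(K', \<kappa>) \<in> partial_automorphism_rel G `` {partial_automorphism_comp p r}"
    then have rel: "(partial_automorphism_comp p r, K', \<kappa>) \<in> partial_automorphism_rel G"
      by simp
    obtain H \<alpha> K \<beta> where eq: "p = (H, \<alpha>)" "r = (K, \<beta>)"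
      by (metis surj_pair)
    obtain A where A: "finite_index_subgroup A G" "A \<subseteq> H" "\<And>x. x \<in> A \<Longrightarrow> \<alpha> x = \<phi> x"
      using p unfolding eq mem_commensurator_class_iff[OF \<phi>] by blast
    obtain B where B: "finite_index_subgroup B G" "B \<subseteq> K" "\<And>x. x \<in> B \<Longrightarrow> \<beta> x = \<psi> x"
      using r unfolding eq mem_commensurator_class_iff[OF \<psi>] by blast
    obtain C where C: "finite_index_subgroup C G" "C \<subseteq> K'"
        "\<And>x. x \<in> C \<Longrightarrow> snd (partial_automorphism_comp p r) x = \<kappa> x"
      and K': "(K', \<kappa>) \<in> partial_automorphisms G"
      using rel by (auto simp: partial_automorphism_rel_def)
    \<comment> \<open>On \<open>L\<close> all three agreements apply: \<kappa> with the composite at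
      \<open>x\<close>, \<beta> with \<psi> at \<open>x\<close>, and \<alpha> with \<phi> at
      \<open>\<psi> x\<close>, which lies in \<open>A\<close>.\<close>
    define L where "L = C \<inter> (B \<inter> {x \<in> carrier G. \<psi> x \<in> A})"
    have "finite_index_subgroup L G"
      unfolding L_def using A(1) B(1) C(1) \<psi>
      by (intro finite_index_subgroup_Int finite_index_subgroup_vimage) (auto simp: iso_def)
    moreover have "\<kappa> x = (\<phi> \<circ> \<psi>) x" if "x \<in> L" for x
      using that A(2,3) B(2,3) C(3)[of x] by (auto simp: L_def eq Let_def subset_iff)
    ultimately show "(K', \<kappa>) \<in> commensurator_class G (\<phi> \<circ> \<psi>)"
      using K' C(2) unfolding mem_commensurator_class_iff[OF \<phi>\<psi>] L_def by blast
  qed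
  have mem: "(carrier G, restrict \<chi> (carrier G)) \<in> commensurator_class G \<chi>" if "\<chi> \<in> iso G G" for \<chi>
    using partial_automorphism_rel_refl[OF automorphism_partial_automorphism[OF that]]
    by (simp add: commensurator_class_def)
  have "{x \<in> carrier G. restrict \<psi> (carrier G) x \<in> carrier G} = carrier G"
    using closed by auto
  then have "partial_automorphism_comp (carrier G, restrict \<phi> (carrier G)) (carrier G, restrict \<psi> (carrier G)) =
      (carrier G, restrict (\<phi> \<circ> \<psi>) (carrier G))"
    using closed by (auto simp: Let_def restrict_def fun_eq_iff)
  then have "commensurator_class G (\<phi> \<circ> \<psi>) = partial_automorphism_rel G ``
      {partial_automorphism_comp (carrier G, restrict \<phi> (carrier G)) (carrier G, restrict \<psi> (carrier G))}"
    by (simp add: commensurator_class_def)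
  \<comment> \<open>One pair of representatives suffices for this inclusion: the two automorphisms
    themselves, whose composite has full domain.\<close>
  then have "commensurator_class G (\<phi> \<circ> \<psi>) \<subseteq> (\<Union>p\<in>commensurator_class G \<phi>. \<Union>r\<in>commensurator_class G \<psi>.
      partial_automorphism_rel G `` {partial_automorphism_comp p r})"
    using mem[OF \<phi>] mem[OF \<psi>] by blast
  moreover have "(\<Union>p\<in>commensurator_class G \<phi>. \<Union>r\<in>commensurator_class G \<psi>.
      partial_automorphism_rel G `` {partial_automorphism_comp p r}) \<subseteq> commensurator_class G (\<phi> \<circ> \<psi>)"
    using sub by (intro UN_least)
  ultimately show ?thesis
    by (simp add: commensurator_def)
qed

end


section \<open>Permutations of the coordinates\<close>

lemma group_additive_group: "group additive_group"
  by (rule groupI)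
    (auto simp: additive_group_def add.assoc intro: exI[of _ "- _"])

lemma inv_additive_group: "inv\<^bsub>additive_group\<^esub> x = - x"
  using group.inv_equality[OF group_additive_group, of "- x" x] by (simp add: additive_group_def)

text \<open>For injective \<sigma>, \<open>map_key\<close> is precomposition with \<sigma>. It is
  additive, and precomposition with the inverse permutation inverts it.\<close>

lemma map_key_iso:
  fixes \<sigma> :: "'k \<Rightarrow> 'k"
  assumes "bij \<sigma>"
  shows "Poly_Mapping.map_key \<sigma> \<in> iso additive_group (additive_group :: ('k \<Rightarrow>\<^sub>0 'a::ab_group_add) monoid)"
proof -
  have inj: "inj \<sigma>" "inj (inv_into UNIV \<sigma>)" and comp: "\<sigma> \<circ> inv_into UNIV \<sigma> = (\<lambda>x. x)" "inv_into UNIV \<sigma> \<circ> \<sigma> = (\<lambda>x. x)"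
    using assms by (auto simp: bij_is_inj bij_imp_bij_inv fun_eq_iff bij_is_surj surj_f_inv_f)
  have "bij (Poly_Mapping.map_key \<sigma> :: ('k \<Rightarrow>\<^sub>0 'a) \<Rightarrow> _)"
    by (rule o_bij[of "Poly_Mapping.map_key (inv_into UNIV \<sigma>)"])
      (simp_all add: fun_eq_iff map_key_compose inj comp map_key_id)
  then show ?thesis
    by (auto simp: iso_def hom_def additive_group_def map_key_plus[OF inj(1)])
qed

text \<open>Pigeonhole: infinitely many unit vectors at positions \<open>p k\<close> lie in finitely
  many cosets of \<open>L\<close>, so some difference of two lies in \<open>L\<close> and tells
  \<open>p\<close> from \<open>r\<close>. Hence permutations that differ at infinitely many indices
  give distinct classes in the commensurator.\<close>

lemma finite_index_subgroup_separates:
  fixes L :: "('k \<Rightarrow>\<^sub>0 'a::{ab_group_add,zero_neq_one}) set" and p r :: "'k \<Rightarrow> 'k"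
  assumes L: "finite_index_subgroup L additive_group"
    and inj: "inj p" and inf: "infinite {k. p k \<noteq> r k}"
  obtains x k where "x \<in> L" "Poly_Mapping.lookup x (p k) \<noteq> Poly_Mapping.lookup x (r k)"
proof -
  note L' = group.finite_index_subgroupD[OF group_additive_group L]
  define e :: "'k \<Rightarrow> 'k \<Rightarrow>\<^sub>0 'a" where "e k = Poly_Mapping.single (p k) 1" for k
  define f where "f k = L #>\<^bsub>additive_group\<^esub> e k" for k
  have "finite (f ` {k. p k \<noteq> r k})"
    by (rule finite_subset[OF _ L'(2)]) (auto simp: f_def additive_group_def)
  then obtain k where k: "p k \<noteq> r k" and "infinite {k' \<in> {k. p k \<noteq> r k}. f k' = f k}"
    using pigeonhole_infinite[OF inf] by blast
  \<comment> \<open>The second unit vector must avoid the positions \<open>p k\<close> and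
    \<open>r k\<close>; as \<open>p\<close> is injective, this excludes only finitely many
    \<open>k'\<close>.\<close>
  moreover have "finite {k'. p k' \<in> {p k, r k}}"
    using finite_vimageI[OF _ inj, of "{p k, r k}"] by (simp add: vimage_def)
  ultimately have "infinite ({k' \<in> {k. p k \<noteq> r k}. f k' = f k} - {k'. p k' \<in> {p k, r k}})"
    by (rule_tac Diff_infinite_finite)
  then obtain k' where f: "f k' = f k" and k': "p k' \<noteq> p k" "p k' \<noteq> r k"
    by (auto dest!: infinite_imp_nonempty)
  have carrier: "e k \<in> carrier additive_group" for k
    by (simp add: additive_group_def)
  have "e k \<otimes>\<^bsub>additive_group\<^esub> inv\<^bsub>additive_group\<^esub> (e k') \<in> L"
    by (rule L'(3)[OF carrier carrier]) (use f in \<open>simp add: f_def\<close>)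
  then have "e k - e k' \<in> L"
    unfolding inv_additive_group by (simp add: additive_group_def)
  \<comment> \<open>The two coefficients are 1 and 0.\<close>
  moreover have "Poly_Mapping.lookup (e k - e k') (p k) \<noteq> Poly_Mapping.lookup (e k - e k') (r k)"
    using k k' by (simp add: e_def lookup_minus lookup_single)
  ultimately show thesis
    by (rule that)
qed

text \<open>Permutations supported in different rows commute. Within row \<open>i\<close> the two
  composites of the reflections are the translations by -1 and by 1, which differ at every
  point.\<close>

lemma permutation_commutation_pattern:
  obtains \<sigma> \<tau> :: "nat \<Rightarrow> int \<Rightarrow> int"
  where "\<And>i. bij (\<sigma> i)" "\<And>i. bij (\<tau> i)" "\<And>i j. i \<noteq> j \<Longrightarrow> \<sigma> i \<circ> \<tau> j = \<tau> j \<circ> \<sigma> i"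
    "\<And>i. infinite {k. (\<sigma> i \<circ> \<tau> i) k \<noteq> (\<tau> i \<circ> \<sigma> i) k}"
proof -
  \<comment> \<open>A bijection from the integers to \<open>nat \<times> int\<close>, through
    \<open>nat\<close> and \<open>nat \<times> nat\<close>.\<close>
  define e where "e = map_prod id int_decode \<circ> prod_decode \<circ> int_encode"
  have e: "bij e"
    unfolding e_def
    using bij_betw_map_prod[OF bij_id bij_int_decode]
    by (auto intro!: bij_comp bij_int_encode bij_prod_decode)
  define row where "row g i k = inv_into UNIV e (fst (e k), if fst (e k) = i then g (snd (e k)) else snd (e k))"
    for g :: "int \<Rightarrow> int" and i k
  have e_row: "e (row g i k) = (fst (e k), if fst (e k) = i then g (snd (e k)) else snd (e k))" for g i k
    using e by (simp add: row_def bij_is_surj surj_f_inv_f)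
  have eqI: "k = k'" if "e k = e k'" for k k'
    using e that by (simp add: bij_is_inj inj_eq)
  let ?\<sigma> = "row uminus" and ?\<tau> = "row (\<lambda>x. 1 - x)"
  show thesis
  proof (rule that)
    \<comment> \<open>Both reflections are involutions.\<close>
    show "bij (?\<sigma> i)" "bij (?\<tau> i)" for i
      by (rule involuntory_imp_bij, rule eqI, simp add: e_row prod_eq_iff)+
    show "?\<sigma> i \<circ> ?\<tau> j = ?\<tau> j \<circ> ?\<sigma> i" if "i \<noteq> j" for i j
      by (rule ext, rule eqI) (use that in \<open>simp add: e_row\<close>)
    show "infinite {k. (?\<sigma> i \<circ> ?\<tau> i) k \<noteq> (?\<tau> i \<circ> ?\<sigma> i) k}" for i
    proof (rule infinite_super)
      show "range (\<lambda>x. inv_into UNIV e (i, x)) \<subseteq> {k. (?\<sigma> i \<circ> ?\<tau> i) k \<noteq> (?\<tau> i \<circ> ?\<sigma> i) k}"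
      proof (clarsimp)
        fix x
        assume "?\<sigma> i (?\<tau> i (inv_into UNIV e (i, x))) = ?\<tau> i (?\<sigma> i (inv_into UNIV e (i, x)))"
        \<comment> \<open>In row coordinates the equation reads
          \<open>x - 1 = x + 1\<close>.\<close>
        from arg_cong[OF this, of e] show False
          using e by (simp add: e_row bij_is_surj surj_f_inv_f)
      qed
      have "inj (\<lambda>x. inv_into UNIV e (i, x))"
        using bij_is_inj[OF bij_imp_bij_inv[OF e]] by (auto simp: inj_def)
      then show "infinite (range (\<lambda>x. inv_into UNIV e (i, x)))"
        by (simp add: finite_image_iff infinite_UNIV_int)
    qed
  qed
qed

section \<open>Transport of the commutation pattern to matrices\<close>

theorem proposition4p2:
  fixes n :: nat and G :: "'f::field alg_closure mat set"
  assumes "linear_algebraic_group n G"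
  shows "\<not> (\<exists>\<Phi>. \<Phi> \<in> mon (commensurator (additive_group :: 'q::{field,finite} laurent_poly monoid))
                         (rational_points n G))"
proof
  let ?V = "additive_group :: 'q laurent_poly monoid"
  interpret V: group ?V
    by (rule group_additive_group)
  assume "\<exists>\<Phi>. \<Phi> \<in> mon (commensurator ?V) (rational_points n G)"
  then obtain \<Phi> where hom: "\<Phi> \<in> hom (commensurator ?V) (rational_points n G)"
    and inj: "inj_on \<Phi> (carrier (commensurator ?V))"
    by (auto simp: mon_def)
  obtain \<sigma> \<tau> :: "nat \<Rightarrow> int \<Rightarrow> int"
    where \<sigma>: "\<And>i. bij (\<sigma> i)" and \<tau>: "\<And>i. bij (\<tau> i)"
      and comm: "\<And>i j. i \<noteq> j \<Longrightarrow> \<sigma> i \<circ> \<tau> j = \<tau> j \<circ> \<sigma> i"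
      and non_comm: "\<And>i. infinite {k. (\<sigma> i \<circ> \<tau> i) k \<noteq> (\<tau> i \<circ> \<sigma> i) k}"
    by (rule permutation_commutation_pattern) (rule that)
  define cl where "cl \<rho> = commensurator_class ?V (Poly_Mapping.map_key \<rho>)" for \<rho>
  have cl: "cl \<rho> \<in> carrier (commensurator ?V)" if "bij \<rho>" for \<rho>
    unfolding cl_def by (rule V.commensurator_class_closed[OF map_key_iso[OF that]])
  \<comment> \<open>Precomposition reverses the order of composition; this is harmless, since
    commuting is a symmetric condition.\<close>
  have cl_mult: "cl \<rho> \<otimes>\<^bsub>commensurator ?V\<^esub> cl \<rho>' = cl (\<rho>' \<circ> \<rho>)" if "bij \<rho>" "bij \<rho>'" for \<rho> \<rho>'
  proof -
    have "Poly_Mapping.map_key \<rho> \<circ> Poly_Mapping.map_key \<rho>' =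
        (Poly_Mapping.map_key (\<rho>' \<circ> \<rho>) :: 'q laurent_poly \<Rightarrow> _)"
      using that by (simp add: fun_eq_iff map_key_compose bij_is_inj)
    then show ?thesis
      using that by (simp add: cl_def V.commensurator_class_mult map_key_iso)
  qed
  have \<Phi>_carrier: "\<Phi> (cl \<rho>) \<in> carrier_mat n n" if "bij \<rho>" for \<rho>
  proof -
    have "\<Phi> (cl \<rho>) \<in> carrier (rational_points n G)"
      using hom cl[OF that] by (auto simp: hom_def)
    then show ?thesis
      by (auto simp: rational_points_def GL_def units_of_def Units_def ring_mat_def)
  qed
  have \<Phi>_mult: "\<Phi> (cl \<rho>) * \<Phi> (cl \<rho>') = \<Phi> (cl (\<rho>' \<circ> \<rho>))" if "bij \<rho>" "bij \<rho>'" for \<rho> \<rho>'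
    using hom_mult[OF hom cl[OF that(1)] cl[OF that(2)]] cl_mult[OF that]
    by (simp add: rational_points_def GL_def units_of_def ring_mat_def)
  obtain i where "\<Phi> (cl (\<sigma> i)) * \<Phi> (cl (\<tau> i)) = \<Phi> (cl (\<tau> i)) * \<Phi> (cl (\<sigma> i))"
    by (rule mat_commutation_pattern[of "\<lambda>i. \<Phi> (cl (\<sigma> i))" n "\<lambda>i. \<Phi> (cl (\<tau> i))"])
      (auto simp: \<Phi>_carrier \<Phi>_mult \<sigma> \<tau> comm)
  then have "\<Phi> (cl (\<tau> i \<circ> \<sigma> i)) = \<Phi> (cl (\<sigma> i \<circ> \<tau> i))"
    by (simp add: \<Phi>_mult \<sigma> \<tau>)
  moreover have bij: "bij (\<tau> i \<circ> \<sigma> i)" "bij (\<sigma> i \<circ> \<tau> i)"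
    using \<sigma> \<tau> by (auto intro: bij_comp)
  \<comment> \<open>Injectivity carries the accidental commutation of two matrices back to the
    commensurator, where it means agreement on a finite-index subgroup.\<close>
  ultimately have "cl (\<sigma> i \<circ> \<tau> i) = cl (\<tau> i \<circ> \<sigma> i)"
    using inj_onD[OF inj] cl by metis
  then obtain L where L: "finite_index_subgroup L ?V"
    and eq: "\<And>x. x \<in> L \<Longrightarrow> Poly_Mapping.map_key (\<sigma> i \<circ> \<tau> i) x = Poly_Mapping.map_key (\<tau> i \<circ> \<sigma> i) x"
    using V.commensurator_class_eqD[OF map_key_iso[OF bij(2)] map_key_iso[OF bij(1)]]
    unfolding cl_def by metis
  obtain x k where x: "x \<in> L"
    and "Poly_Mapping.lookup x ((\<sigma> i \<circ> \<tau> i) k) \<noteq> Poly_Mapping.lookup x ((\<tau> i \<circ> \<sigma> i) k)"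
    using finite_index_subgroup_separates[OF L bij_is_inj[OF bij(2)] non_comm] by blast
  \<comment> \<open>Comparing coefficients at \<open>k\<close> turns the agreement at
    \<open>x\<close> into equality of the two coefficients just separated.\<close>
  then show False
    using arg_cong[OF eq[OF x], of "\<lambda>y. Poly_Mapping.lookup y k"] bij
    by (simp add: Poly_Mapping.map_key.rep_eq bij_is_inj)
qed

end
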